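(* Let $n\ge 2$. If $\Psi:\mathrm{Conv}(\mathbb{R}^n,\mathbb{R})\to\mathbb{R}^n$ is a continuous, dually epi-translation-invariant and $\mathrm{SL}(n,\mathbb{R})$-equivariant valuation, then $\Psi(f)=0$ for every $f\in\mathrm{Conv}(\mathbb{R}^n,\mathbb{R})$.
   Context: $\mathrm{Conv}(\mathbb{R}^n,\mathbb{R})$ is the space of all finite convex functions $f:\mathbb{R}^n\to\mathbb{R}$, with the topology induced by epi-convergence (on this space it coincides with the topology of pointwise convergence and with that of locally uniform convergence); continuity of $\Psi$ is with respect to this topology. $\Psi$ is a valuation if $\Psi(\max\{f,h\})+\Psi(\min\{f,h\})=\Psi(f)+\Psi(h)$ whenever $f,h,\min\{f,h\}\in\mathrm{Conv}(\mathbb{R}^n,\mathbb{R})$ (pointwise maximum and minimum). $\Psi$ is dually epi-translation-invariant if $\Psi(f+\ell)=\Psi(f)$ for all $f\in\mathrm{Conv}(\mathbb{R}^n,\mathbb{R})$ and all affine maps $\ell:\mathbb{R}^n\to\mathbb{R}$. For a map with values in $\mathbb{R}^n$, $\mathrm{SL}(n,\mathbb{R})$-equivariance means $\Psi(f\circ g^{-1})=g\,\Psi(f)$ for all $f\in\mathrm{Conv}(\mathbb{R}^n,\mathbb{R})$ and $g\in\mathrm{SL}(n,\mathbb{R})$. *)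

theory Defs
  imports "HOL-Analysis.Analysis"
begin

definition Conv :: "(real ^ 'n \<Rightarrow> real) set"
  where "Conv = {f. convex_on UNIV f}"

definition epi_converges :: "(nat \<Rightarrow> real ^ 'n \<Rightarrow> real) \<Rightarrow> (real ^ 'n \<Rightarrow> real) \<Rightarrow> bool"
  where "epi_converges F f \<longleftrightarrow>
    (\<forall>x. (\<forall>X. X \<longlonglongrightarrow> x \<longrightarrow> ereal (f x) \<le> liminf (\<lambda>k. ereal (F k (X k)))) \<and>
         (\<exists>X. X \<longlonglongrightarrow> x \<and> (\<lambda>k. F k (X k)) \<longlonglongrightarrow> f x))"

(* The finest topology on Conv in which every epi-convergent sequence converges to its
   epi-limit.  Epi-convergence on Conv is convergence in a metrizable topology (e.g. that of
   locally uniform convergence), so this is that topology. *)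
definition epi_open :: "(real ^ 'n \<Rightarrow> real) set \<Rightarrow> bool"
  where "epi_open U \<longleftrightarrow> U \<subseteq> Conv \<and>
    (\<forall>F f. (\<forall>k. F k \<in> Conv) \<longrightarrow> f \<in> U \<longrightarrow> epi_converges F f \<longrightarrow>
       eventually (\<lambda>k. F k \<in> U) sequentially)"

definition epi_topology :: "(real ^ 'n \<Rightarrow> real) topology"
  where "epi_topology = topology epi_open"

lemma istopology_epi_open: "istopology epi_open"
  unfolding istopology_def
proof (intro conjI allI impI)
  fix S T :: "(real ^ 'n \<Rightarrow> real) set"
  assume "epi_open S" "epi_open T"
  then show "epi_open (S \<inter> T)"
    unfolding epi_open_def by (auto simp: eventually_conj_iff)
next
  fix K :: "(real ^ 'n \<Rightarrow> real) set set"
  assume K: "\<forall>S\<in>K. epi_open S"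
  show "epi_open (\<Union>K)"
    unfolding epi_open_def
  proof (intro conjI allI impI)
    show "\<Union>K \<subseteq> Conv"
      using K unfolding epi_open_def by blast
  next
    fix F and f :: "real ^ 'n \<Rightarrow> real"
    assume F: "\<forall>k. F k \<in> Conv" "epi_converges F f" and "f \<in> \<Union>K"
    then obtain S where "S \<in> K" "f \<in> S"
      by blast
    with K F have "eventually (\<lambda>k. F k \<in> S) sequentially"
      unfolding epi_open_def by blast
    then show "eventually (\<lambda>k. F k \<in> \<Union>K) sequentially"
      using \<open>S \<in> K\<close> by (auto elim: eventually_mono)
  qed
qed

lemma openin_epi_topology: "openin epi_topology U \<longleftrightarrow> epi_open U"
  unfolding epi_topology_def by (simp add: topology_inverse' istopology_epi_open)

lemma topspace_epi_topology: "topspace epi_topology = Conv"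
proof -
  have "epi_open Conv"
    by (auto simp: epi_open_def)
  then show ?thesis
    by (metis epi_open_def openin_epi_topology openin_subset openin_topspace subset_antisym)
qed

lemma limitin_epi_topology:
  assumes "\<And>k. F k \<in> Conv" "f \<in> Conv" "epi_converges F f"
  shows "limitin epi_topology F f sequentially"
  using assms unfolding limitin_def openin_epi_topology topspace_epi_topology
  by (auto simp: epi_open_def)

definition is_valuation :: "((real ^ 'n \<Rightarrow> real) \<Rightarrow> 'b::real_vector) \<Rightarrow> bool"
  where "is_valuation \<Psi> \<longleftrightarrow>
    (\<forall>f\<in>Conv. \<forall>h\<in>Conv. (\<lambda>x. min (f x) (h x)) \<in> Conv \<longrightarrow>
       \<Psi> (\<lambda>x. max (f x) (h x)) + \<Psi> (\<lambda>x. min (f x) (h x)) = \<Psi> f + \<Psi> h)"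

definition dually_epi_translation_invariant :: "((real ^ 'n \<Rightarrow> real) \<Rightarrow> 'b) \<Rightarrow> bool"
  where "dually_epi_translation_invariant \<Psi> \<longleftrightarrow>
    (\<forall>f\<in>Conv. \<forall>l c. linear l \<longrightarrow> \<Psi> (\<lambda>x. f x + (l x + c)) = \<Psi> f)"

definition SL_equivariant :: "((real ^ 'n \<Rightarrow> real) \<Rightarrow> real ^ 'n) \<Rightarrow> bool"
  where "SL_equivariant \<Psi> \<longleftrightarrow>
    (\<forall>f\<in>Conv. \<forall>g :: real ^ 'n ^ 'n. det g = 1 \<longrightarrow>
       \<Psi> (f \<circ> (\<lambda>x. matrix_inv g *v x)) = g *v \<Psi> f)"

end

theory Submission
  imports Defs
begin

text \<open>
  A finite convex function is the epi-limit of maxima of finitely many affine functions, so by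
  continuity it suffices that \<open>\<Psi>\<close> vanishes on those. A finite set of pairs \<open>(v, c)\<close>, each standing
  for the affine function \<open>x \<mapsto> v \<bullet> x + c\<close>, describes such a maximum. Three mechanisms carry the proof.

  \<^item> \<^emph>\<open>Cutting an edge.\<close> If \<open>l\<close> is a convex combination of the affine functions \<open>a\<close> and \<open>b\<close>, then for
    every \<open>r\<close> the minimum of \<open>max a l r\<close> and \<open>max l b r\<close> is \<open>max l r\<close>, which is convex, and their maximum
    is \<open>max a b r\<close>. The valuation property therefore applies (\<open>edge_cut\<close>). This is the
    dissection of a simplex by a hyperplane through all but two of its vertices, read on the side
    of support functions. Guided by a Radon partition of the gradients it reduces everything to
    affinely independent gradients (\<open>Psi_zero_by_merging\<close>).

  \<^item> \<^emph>\<open>Compact support.\<close> The sequence \<open>m \<mapsto> \<Psi> (m f)\<close> is polynomial in \<open>m\<close> when \<open>f\<close> is a maximum of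
    affine functions, and it starts with \<open>\<Psi> 0 = 0\<close>. So if \<open>\<Psi> f \<noteq> 0\<close>, it is unbounded. Functions \<open>f\<close>
    vanishing on larger and larger balls with \<open>\<Psi> f \<noteq> 0\<close> could then be multiplied to have values of
    norm at least one although they converge to zero. Hence there is a radius \<open>r\<close> such that
    \<open>\<Psi> f = 0\<close> whenever \<open>f\<close> vanishes on the ball of radius \<open>r\<close> (\<open>vanishing_radius_exists\<close>).

  \<^item> \<^emph>\<open>Volume-preserving maps.\<close> By equivariance, the ball may be replaced by any ellipsoid of the same
    volume centred at the origin. A function \<open>max 0 (v\<^sub>i \<bullet> x - c\<^sub>i)\<close> with positive \<open>c\<^sub>i\<close> and linearly
    independent \<open>v\<^sub>i\<close> vanishes on such an ellipsoid if there are fewer than \<open>n\<close> of the \<open>v\<^sub>i\<close>, or if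
    their determinant is small compared with the \<open>c\<^sub>i\<close>. Cutting an edge at its midpoint halves the
    determinant and does not decrease the smallest \<open>c\<^sub>i\<close>, and the remaining term has fewer than \<open>n\<close>
    gradients. Repeated halving thus gives \<open>\<Psi> = 0\<close> for all simplices (\<open>Psi_hinges_zero\<close>).
\<close>

section \<open>Maxima of finitely many affine functions\<close>

text \<open>
  A pair \<open>(v, c)\<close> acts on \<open>x\<close> through the inner product with \<open>(x, 1)\<close>, so that convex combinations of
  affine functions are convex combinations of points in a Euclidean space of one dimension more.
\<close>

definition max_affine :: "((real ^ 'n) \<times> real) set \<Rightarrow> real ^ 'n \<Rightarrow> real"
  where "max_affine A x = Max ((\<lambda>p. p \<bullet> (x, 1)) ` A)"

lemma max_affine_singleton [simp]: "max_affine {p} x = p \<bullet> (x, 1)"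
  by (simp add: max_affine_def)

lemma max_affine_insert:
  assumes "finite A" "A \<noteq> {}"
  shows "max_affine (insert p A) x = max (p \<bullet> (x, 1)) (max_affine A x)"
  using assms by (simp add: max_affine_def)

lemma max_affine_ge: "finite A \<Longrightarrow> p \<in> A \<Longrightarrow> p \<bullet> (x, 1) \<le> max_affine A x"
  by (simp add: max_affine_def)

lemma max_affine_le_iff:
  "finite A \<Longrightarrow> A \<noteq> {} \<Longrightarrow> max_affine A x \<le> c \<longleftrightarrow> (\<forall>p\<in>A. p \<bullet> (x, 1) \<le> c)"
  by (simp add: max_affine_def)

lemma max_affine_cong_image:
  assumes "finite A" "A \<noteq> {}" "\<And>p. p \<in> A \<Longrightarrow> h p \<bullet> (x, 1) = p \<bullet> (y, 1) + c"
  shows "max_affine (h ` A) x = max_affine A y + c"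
proof -
  have "(\<lambda>p. p \<bullet> (x, 1)) ` h ` A = (\<lambda>p. p \<bullet> (y, 1) + c) ` A"
    using assms(3) by (force simp: image_image)
  moreover have "Max ((\<lambda>p. p \<bullet> (y, 1) + c) ` A) = max_affine A y + c"
    unfolding max_affine_def using assms by (intro Max_add_commute) auto
  ultimately show ?thesis by (simp add: max_affine_def)
qed

lemma convex_hull_le_max_affine:
  assumes "finite A" "q \<in> convex hull A"
  shows "q \<bullet> (x, 1) \<le> max_affine A x"
proof -
  have "convex hull A \<subseteq> {q. (x, 1) \<bullet> q \<le> max_affine A x}"
    using max_affine_ge[OF assms(1)] by (intro hull_minimal convex_halfspace_le) (auto simp: inner_commute)
  with assms(2) show ?thesis by (auto simp: inner_commute)
qed

lemma Conv_add: "f \<in> Conv \<Longrightarrow> h \<in> Conv \<Longrightarrow> (\<lambda>x. f x + h x) \<in> Conv"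
  by (simp add: Conv_def convex_on_add)

lemma Conv_cmul: "f \<in> Conv \<Longrightarrow> 0 \<le> c \<Longrightarrow> (\<lambda>x. c * f x) \<in> Conv"
  by (simp add: Conv_def convex_on_cmul)

lemma Conv_affine: "(\<lambda>x. p \<bullet> (x, 1 :: real)) \<in> Conv"
  unfolding Conv_def
  by (cases p) (auto intro!: convex_onI simp: inner_add_right algebra_simps)

lemma Conv_max:
  assumes "f \<in> Conv" "h \<in> Conv"
  shows "(\<lambda>x. max (f x) (h x)) \<in> Conv"
  unfolding Conv_def
proof (intro CollectI convex_onI)
  fix t :: real and x y :: "real ^ 'a"
  assume t: "0 < t" "t < 1"
  let ?z = "(1 - t) *\<^sub>R x + t *\<^sub>R y"
  have "f ?z \<le> (1 - t) * f x + t * f y" "h ?z \<le> (1 - t) * h x + t * h y"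
    using assms t by (auto simp: Conv_def intro: convex_onD)
  moreover have "(1 - t) * f x \<le> (1 - t) * max (f x) (h x)" "t * f y \<le> t * max (f y) (h y)"
      "(1 - t) * h x \<le> (1 - t) * max (f x) (h x)" "t * h y \<le> t * max (f y) (h y)"
    using t by (auto intro!: mult_left_mono)
  ultimately show "max (f ?z) (h ?z) \<le> (1 - t) * max (f x) (h x) + t * max (f y) (h y)"
    by linarith
qed auto

lemma Conv_max_affine: "finite A \<Longrightarrow> A \<noteq> {} \<Longrightarrow> max_affine A \<in> Conv"
proof (induction A rule: finite_ne_induct)
  case (singleton p)
  then show ?case using Conv_affine[of p] by (simp add: max_affine_def[abs_def])
next
  case (insert p A)
  then have "max_affine (insert p A) = (\<lambda>x. max (p \<bullet> (x, 1)) (max_affine A x))"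
    by (intro ext max_affine_insert)
  then show ?case using Conv_max[OF Conv_affine insert.IH] by simp
qed

lemma Conv_continuous: "f \<in> Conv \<Longrightarrow> continuous_on UNIV f"
  by (simp add: Conv_def convex_on_continuous)

lemma Conv_tendsto:
  assumes "f \<in> Conv" "X \<longlonglongrightarrow> x"
  shows "(\<lambda>k. f (X k)) \<longlonglongrightarrow> f x"
  using continuous_on_tendsto_compose[OF Conv_continuous[OF assms(1)] assms(2)] by simp

text \<open>
  The open strict epigraph is separated from the point \<open>(q, f q)\<close> of its boundary. The separating
  hyperplane is not vertical because \<open>f\<close> is finite everywhere.
\<close>

lemma subgradient_exists:
  fixes f :: "real ^ 'n \<Rightarrow> real"
  assumes "f \<in> Conv"
  obtains p :: "(real ^ 'n) \<times> real" where "p \<bullet> (q, 1) = f q" "\<And>x. p \<bullet> (x, 1) \<le> f x"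
proof -
  let ?S = "{(x, t). f x < t}"
  have "convex ?S"
  proof (rule convexI, clarsimp)
    fix x y :: "real ^ 'n" and s t u v :: real
    assume *: "f x < s" "f y < t" "0 \<le> u" "0 \<le> v" "u + v = 1"
    have "f (u *\<^sub>R x + v *\<^sub>R y) \<le> u * f x + v * f y"
      using assms * by (simp add: Conv_def convex_on_def)
    also have "\<dots> < u * s + v * t"
    proof (cases "u = 0")
      case False
      then show ?thesis using * by (intro add_less_le_mono mult_strict_left_mono mult_left_mono) auto
    qed (use * in auto)
    finally show "f (u *\<^sub>R x + v *\<^sub>R y) < u * s + v * t" .
  qed
  then have "\<exists>a c. a \<noteq> 0 \<and> (\<forall>z\<in>{(q, f q)}. a \<bullet> z \<le> c) \<and> (\<forall>z\<in>?S. c \<le> a \<bullet> z)"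
  proof (intro separating_hyperplane_sets)
    have "(q, f q + 1) \<in> ?S" by simp
    then show "?S \<noteq> {}" by blast
  qed auto
  then obtain a c
    where ac: "a \<noteq> 0" "\<forall>z\<in>{(q, f q)}. a \<bullet> z \<le> c" "\<forall>z\<in>?S. c \<le> a \<bullet> z"
    by blast
  obtain w b where a: "a = (w, b)" by (cases a)
  have sep: "w \<bullet> q + b * f q \<le> w \<bullet> x + b * t" if "f x < t" for x t
  proof -
    have "(x, t) \<in> ?S" using that by simp
    with ac(2,3) show ?thesis unfolding a by (fastforce simp: inner_prod_def)
  qed
  have "b \<ge> 0"
    using sep[of q "f q + 1"] by (simp add: algebra_simps)
  moreover have "b \<noteq> 0"
  proof
    assume "b = 0"
    then have "w \<bullet> q \<le> w \<bullet> (q - w)"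
      using sep[of "q - w" "f (q - w) + 1"] by simp
    then have "w \<bullet> w \<le> 0" by (simp add: inner_diff_right)
    then have "w = 0" by (metis inner_eq_zero_iff inner_ge_zero order_antisym)
    with \<open>b = 0\<close> a ac(1) show False by (simp add: zero_prod_def)
  qed
  ultimately have b: "b > 0" by simp
  have below: "w \<bullet> q + b * f q \<le> w \<bullet> x + b * f x" for x
  proof (rule field_le_epsilon)
    fix e :: real assume "e > 0"
    then show "w \<bullet> q + b * f q \<le> w \<bullet> x + b * f x + e"
      using sep[of x "f x + e / b"] b by (simp add: algebra_simps)
  qed
  show thesis
  proof (rule that[of "(- w /\<^sub>R b, f q + w \<bullet> q / b)"])
    show "(- w /\<^sub>R b, f q + w \<bullet> q / b) \<bullet> (q, 1) = f q"
      using b by (simp add: inner_prod_def divide_simps)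
    fix x
    have "(w \<bullet> q + b * f q - w \<bullet> x) / b \<le> f x"
      using b below[of x] by (simp add: pos_divide_le_eq algebra_simps)
    then have "f q + w \<bullet> q / b - w \<bullet> x / b \<le> f x"
      using b by (simp add: diff_divide_distrib add_divide_distrib)
    then show "(- w /\<^sub>R b, f q + w \<bullet> q / b) \<bullet> (x, 1) \<le> f x"
      by (simp add: inner_prod_def divide_inverse_commute)
  qed
qed

section \<open>Convex functions as epi-limits of maxima of affine functions\<close>

text \<open>
  Continuous convergence is stronger than epi-convergence and is what the perturbations below satisfy:
  the same estimate gives the lower bound along all sequences and a constant recovery sequence.
\<close>

lemma epi_converges_if_continuous_convergence:
  fixes f :: "real ^ 'n \<Rightarrow> real"
  assumes "\<And>x X. X \<longlonglongrightarrow> x \<Longrightarrow> (\<lambda>k. F k (X k)) \<longlonglongrightarrow> f x"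
  shows "epi_converges F f"
  unfolding epi_converges_def
proof (intro allI conjI impI)
  fix x :: "real ^ 'n" and X assume "X \<longlonglongrightarrow> x"
  then have "(\<lambda>k. ereal (F k (X k))) \<longlonglongrightarrow> ereal (f x)"
    using assms by simp
  from lim_imp_Liminf[OF _ this] show "ereal (f x) \<le> liminf (\<lambda>k. ereal (F k (X k)))"
    by simp
next
  fix x :: "real ^ 'n" show "\<exists>X. X \<longlonglongrightarrow> x \<and> (\<lambda>k. F k (X k)) \<longlonglongrightarrow> f x"
    using assms[of "\<lambda>_. x" x] by auto
qed

text \<open>
  Tangents at the points of a countable dense set already have \<open>f\<close> as their supremum, and their
  finite maxima increase to it.
\<close>

lemma Conv_approx_max_affine:
  fixes f :: "real ^ 'n \<Rightarrow> real"
  assumes f: "f \<in> Conv"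
  obtains A :: "nat \<Rightarrow> ((real ^ 'n) \<times> real) set"
    where "\<And>k. finite (A k)" "\<And>k. A k \<noteq> {}" "epi_converges (\<lambda>k. max_affine (A k)) f"
proof -
  obtain D :: "(real ^ 'n) set"
    where D: "countable D" "\<And>U. open U \<Longrightarrow> U \<noteq> {} \<Longrightarrow> \<exists>d\<in>D. d \<in> U"
    using countable_dense_setE by blast
  have "D \<noteq> {}" using D(2)[of UNIV] by auto
  then have range_D: "range (from_nat_into D) = D"
    using D(1) by (simp add: range_from_nat_into)
  have "\<forall>q. \<exists>p :: (real ^ 'n) \<times> real. p \<bullet> (q, 1) = f q \<and> (\<forall>x. p \<bullet> (x, 1) \<le> f x)"
    using subgradient_exists[OF f] by metis
  then obtain p :: "real ^ 'n \<Rightarrow> (real ^ 'n) \<times> real"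
    where p: "\<And>q. p q \<bullet> (q, 1) = f q" "\<And>q x. p q \<bullet> (x, 1) \<le> f x"
    by metis
  define A where "A k = (\<lambda>i. p (from_nat_into D i)) ` {..k}" for k
  have fin: "finite (A k)" "A k \<noteq> {}" for k by (auto simp: A_def)
  have upper: "max_affine (A k) x \<le> f x" for k x
    using fin[of k] by (auto simp: max_affine_le_iff A_def p)
  \<comment> \<open>A tangent at \<open>q\<close> lies below \<open>f\<close> at the mirror image of \<open>x\<close> in \<open>q\<close>; this
    bounds its value at \<open>x\<close> from below without a bound on its slope.\<close>
  have tangent: "2 * f q - f (2 *\<^sub>R q - x) \<le> p q \<bullet> (x, 1)" for q x
  proof -
    have "p q \<bullet> (2 *\<^sub>R q - x, 1) = 2 * (p q \<bullet> (q, 1)) - p q \<bullet> (x, 1)"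
      by (simp add: inner_prod_def inner_diff_right)
    then show ?thesis using p(1)[of q] p(2)[of q "2 *\<^sub>R q - x"] by linarith
  qed
  have dense: "\<exists>i. f x - e < p (from_nat_into D i) \<bullet> (x, 1)" if "e > 0" for x e
  proof -
    have "continuous_on UNIV (\<lambda>q. 2 * f q - f (2 *\<^sub>R q - x))"
      by (intro continuous_intros continuous_on_compose2[OF Conv_continuous[OF f]]) auto
    then have "open ((\<lambda>q. 2 * f q - f (2 *\<^sub>R q - x)) -` {f x - e<..})"
      by (intro open_vimage) auto
    moreover have "x \<in> (\<lambda>q. 2 * f q - f (2 *\<^sub>R q - x)) -` {f x - e<..}"
      using that by (simp add: scaleR_2)
    ultimately have "\<exists>d\<in>D. d \<in> (\<lambda>q. 2 * f q - f (2 *\<^sub>R q - x)) -` {f x - e<..}"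
      using D(2) by blast
    then obtain d where "d \<in> D" "f x - e < 2 * f d - f (2 *\<^sub>R d - x)" by auto
    then have "f x - e < p d \<bullet> (x, 1)" using tangent[of d x] by linarith
    moreover obtain i where "from_nat_into D i = d"
      using \<open>d \<in> D\<close> range_D by (metis imageE)
    ultimately show ?thesis by blast
  qed
  have lower: "\<forall>\<^sub>F k in sequentially. f x - e < max_affine (A k) (X k)"
    if "X \<longlonglongrightarrow> x" "e > 0" for X x e
  proof -
    obtain i where i: "f x - e < p (from_nat_into D i) \<bullet> (x, 1)"
      using dense[OF \<open>e > 0\<close>] by blast
    have "(\<lambda>k. p (from_nat_into D i) \<bullet> (X k, 1)) \<longlonglongrightarrow> p (from_nat_into D i) \<bullet> (x, 1)"
      using that(1) by (intro tendsto_intros)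
    then have "\<forall>\<^sub>F k in sequentially. f x - e < p (from_nat_into D i) \<bullet> (X k, 1)"
      using i by (simp add: order_tendstoD)
    moreover have "\<forall>\<^sub>F k in sequentially. i \<le> k" by simp
    ultimately show ?thesis
    proof eventually_elim
      case (elim k)
      then have "p (from_nat_into D i) \<in> A k" by (auto simp: A_def)
      from max_affine_ge[OF fin(1) this] elim show ?case
        by (meson order_less_le_trans)
    qed
  qed
  have "epi_converges (\<lambda>k. max_affine (A k)) f"
    unfolding epi_converges_def
  proof (intro allI conjI impI)
    fix x :: "real ^ 'n" and X assume X: "X \<longlonglongrightarrow> x"
    show "ereal (f x) \<le> liminf (\<lambda>k. ereal (max_affine (A k) (X k)))"
    proof (rule ereal_le_epsilon2)
      fix e :: real assume "e > 0"
      have "ereal (f x - e) \<le> liminf (\<lambda>k. ereal (max_affine (A k) (X k)))"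
        using lower[OF X \<open>e > 0\<close>] by (intro Liminf_bounded) (auto elim: eventually_mono)
      then show "ereal (f x) \<le> liminf (\<lambda>k. ereal (max_affine (A k) (X k))) + ereal e"
        by (cases "liminf (\<lambda>k. ereal (max_affine (A k) (X k)))") auto
    qed
  next
    fix x :: "real ^ 'n"
    have "(\<lambda>k. max_affine (A k) x) \<longlonglongrightarrow> f x"
    proof (rule order_tendstoI)
      fix a assume "a < f x"
      then show "\<forall>\<^sub>F k in sequentially. a < max_affine (A k) x"
        using lower[of "\<lambda>_. x" x "f x - a"] by simp
    next
      fix a assume "f x < a"
      then show "\<forall>\<^sub>F k in sequentially. max_affine (A k) x < a"
        using upper by (intro always_eventually) (meson order_le_less_trans)
    qed
    then show "\<exists>X. X \<longlonglongrightarrow> x \<and> (\<lambda>k. max_affine (A k) (X k)) \<longlonglongrightarrow> f x"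
      by (intro exI[of _ "\<lambda>_. x"]) auto
  qed
  with fin show thesis by (intro that)
qed

section \<open>Polynomial sequences\<close>

text \<open>
  These are the polynomials of degree at most \<open>d\<close>. Iterated differences describe them without
  coefficients, and a recurrence for the first difference is what the valuation property provides.
\<close>

primrec poly_seq :: "nat \<Rightarrow> (nat \<Rightarrow> 'a::real_normed_vector) \<Rightarrow> bool" where
  "poly_seq 0 P \<longleftrightarrow> (\<forall>m. P m = P 0)"
| "poly_seq (Suc d) P \<longleftrightarrow> poly_seq d (\<lambda>m. P (Suc m) - P m)"

lemma poly_seq_diff: "poly_seq d P \<Longrightarrow> poly_seq d Q \<Longrightarrow> poly_seq d (\<lambda>m. P m - Q m)"
proof (induction d arbitrary: P Q)
  case 0
  then have "\<forall>m. P m = P 0" "\<forall>m. Q m = Q 0" by simp_all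
  then have "P m - Q m = P 0 - Q 0" for m by metis
  then show ?case unfolding poly_seq.simps by blast
next
  case (Suc d)
  then have "poly_seq d (\<lambda>m. (P (Suc m) - P m) - (Q (Suc m) - Q m))" by simp
  then show ?case by (simp add: algebra_simps)
qed

lemma bounded_poly_seq_const:
  assumes "poly_seq d P" "bounded (range P)"
  shows "P m = P 0"
  using assms
proof (induction d arbitrary: P m)
  case 0
  then show ?case unfolding poly_seq.simps by blast
next
  case (Suc d)
  define c where "c = P 1 - P 0"
  have "bounded ((\<lambda>m. P (Suc m)) ` UNIV)"
    using Suc.prems(2) by (rule bounded_subset) auto
  then have "bounded (range (\<lambda>m. P (Suc m) - P m))"
    using Suc.prems(2) by (rule bounded_minus_comp)
  then have "P (Suc m) - P m = c" for m
    using Suc.IH[of "\<lambda>m. P (Suc m) - P m" m] Suc.prems(1) by (simp add: c_def)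
  then have P: "P m = P 0 + real m *\<^sub>R c" for m
    by (induction m) (auto simp: algebra_simps)
  obtain B where "\<forall>p\<in>range P. norm p \<le> B"
    using Suc.prems(2) unfolding bounded_iff by blast
  then have B: "norm (P m) \<le> B" for m by blast
  have "real m * norm c \<le> 2 * B" for m
  proof -
    have "real m * norm c = norm (P m - P 0)" using P[of m] by simp
    also have "\<dots> \<le> norm (P m) + norm (P 0)" by (rule norm_triangle_ineq4)
    finally show ?thesis using B[of m] B[of 0] by simp
  qed
  moreover have "\<exists>m. 2 * B < real m * norm c" if "c \<noteq> 0"
    using that by (intro ex_less_of_nat_mult) simp
  ultimately have "c = 0" by (meson not_le)
  then show ?case using P[of m] by simp
qed

section \<open>Convex hulls, Radon partitions and determinants\<close>

text \<open>
  In a convex combination, the contributions of \<open>a\<close> and \<open>b\<close> can be collected into a single point of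
  the segment between them. If both have weight zero, any point of the segment will do.
\<close>

lemma convex_hull_merge:
  fixes p :: "'a::real_vector"
  assumes "p \<in> convex hull (insert a (insert b K))"
  obtains l where "l \<in> closed_segment a b" "p \<in> convex hull (insert l K)"
proof (cases "K = {}")
  case True
  with assms show ?thesis by (intro that[of p]) (auto simp: segment_convex_hull)
next
  case False
  from assms obtain u v q where q: "u \<ge> 0" "v \<ge> 0" "u + v = 1"
      "q \<in> convex hull (insert b K)" "p = u *\<^sub>R a + v *\<^sub>R q"
    by (subst (asm) convex_hull_insert) auto
  from q(4) obtain u' v' r where r: "u' \<ge> 0" "v' \<ge> 0" "u' + v' = 1"
      "r \<in> convex hull K" "q = u' *\<^sub>R b + v' *\<^sub>R r"
    using False by (subst (asm) convex_hull_insert) auto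
  define s where "s = u + v * u'"
  have "v * u' + v * v' = v"
    using r(3) by (metis distrib_left mult.right_neutral)
  then have s: "s \<ge> 0" "s + v * v' = 1"
    using q(1-3) r(1-3) by (auto simp: s_def)
  have p: "p = (u *\<^sub>R a + (v * u') *\<^sub>R b) + (v * v') *\<^sub>R r"
    using q(5) r(5) by (simp add: algebra_simps)
  show ?thesis
  proof (cases "s = 0")
    case True
    have "0 \<le> v * u'" using q r by simp
    with True q(1) have "u = 0" "v * u' = 0" unfolding s_def by linarith+
    with p s True have "p = r" by simp
    moreover have "r \<in> convex hull (insert a K)"
      using r(4) hull_mono[of K "insert a K" convex] by blast
    ultimately show ?thesis by (intro that[of a]) auto
  next
    case False
    define l where "l = (u / s) *\<^sub>R a + (v * u' / s) *\<^sub>R b"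
    have "u / s + v * u' / s = 1"
      using False by (simp add: s_def flip: add_divide_distrib)
    then have "u / s = 1 - v * u' / s" by simp
    moreover have "0 \<le> v * u' / s" "0 \<le> u / s" using q r s by auto
    ultimately have l: "l \<in> closed_segment a b"
      unfolding closed_segment_def l_def by (intro CollectI exI[of _ "v * u' / s"]) auto
    have "p = s *\<^sub>R l + (v * v') *\<^sub>R r"
      using False by (simp add: p l_def algebra_simps)
    moreover have "l \<in> convex hull (insert l K)" by (simp add: hull_inc)
    moreover have "r \<in> convex hull (insert l K)"
      using r(4) hull_mono[of K "insert l K" convex] by blast
    ultimately have "p \<in> convex hull (insert l K)"
      using s q r by (auto intro!: convexD[OF convex_convex_hull])
    with l show ?thesis by (rule that)
  qed
qed

text \<open>
  The convex hulls of the two sides of a Radon partition of the first components contain points lying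
  above each other; exchanging the sides if necessary, \<open>p\<close> is the lower one. If already two points
  of \<open>A\<close> lie above each other, one of them is split off instead.
\<close>

lemma lifted_Radon_partition:
  fixes A :: "('a::euclidean_space \<times> real) set"
  assumes A: "finite A" and dep: "inj_on fst A \<Longrightarrow> affine_dependent (fst ` A)"
  obtains J I p q where "J \<union> I = A" "J \<inter> I = {}" "J \<noteq> {}" "I \<noteq> {}"
    "p \<in> convex hull J" "q \<in> convex hull I" "fst p = fst q" "snd p \<le> snd q"
proof -
  have "\<exists>J I p q. J \<union> I = A \<and> J \<inter> I = {} \<and> J \<noteq> {} \<and> I \<noteq> {} \<and>
    p \<in> convex hull J \<and> q \<in> convex hull I \<and> fst p = fst q"
  proof (cases "inj_on fst A")
    case False
    then obtain a b where ab: "a \<in> A" "b \<in> A" "a \<noteq> b" "fst a = fst b"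
      by (auto simp: inj_on_def)
    have "b \<in> convex hull (A - {a})" using ab by (intro hull_inc) auto
    moreover have "a \<in> convex hull {a}" by (simp add: hull_inc)
    moreover have "{a} \<union> (A - {a}) = A" "{a} \<inter> (A - {a}) = {}" "A - {a} \<noteq> {}"
      using ab by auto
    ultimately show ?thesis using ab(4) by blast
  next
    case True
    from Radon_partition[of "fst ` A"] A dep[OF True] obtain M N where MN:
      "M \<inter> N = {}" "M \<union> N = fst ` A" "(convex hull M) \<inter> (convex hull N) \<noteq> {}"
      by auto
    then obtain z where z: "z \<in> convex hull M" "z \<in> convex hull N" by blast
    define J where "J = {a \<in> A. fst a \<in> M}"
    define I where "I = {a \<in> A. fst a \<in> N}"
    have "fst ` J = M" "fst ` I = N" using MN(2) by (auto simp: J_def I_def)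
    then have "z \<in> fst ` (convex hull J)" "z \<in> fst ` (convex hull I)"
      using z by (simp_all add: convex_hull_linear_image[OF linear_fst])
    then obtain p q where "p \<in> convex hull J" "q \<in> convex hull I" "fst p = fst q"
      by auto
    moreover from this have "J \<noteq> {}" "I \<noteq> {}" by auto
    moreover have "J \<union> I = A" "J \<inter> I = {}" using MN by (auto simp: J_def I_def)
    ultimately show ?thesis by blast
  qed
  then obtain J I p q where *: "J \<union> I = A" "J \<inter> I = {}" "J \<noteq> {}" "I \<noteq> {}"
    "p \<in> convex hull J" "q \<in> convex hull I" "fst p = fst q" by blast
  show thesis
  proof (cases "snd p \<le> snd q")
    case True
    with * show thesis by (intro that[of J I p q])
  next
    case False
    with * show thesis by (intro that[of I J q p]) auto
  qed
qed

text \<open>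
  Cutting a simplex through the midpoint of an edge halves its volume.
\<close>

lemma det_midpoint_row:
  fixes V :: "real ^ 'n ^ 'n"
  assumes "i \<noteq> j"
  shows "det (\<chi> k. if k = i then (1/2) *\<^sub>R (V $ i + V $ j) else V $ k) = det V / 2"
proof -
  have "det (\<chi> k. if k = i then (1/2) *s (V $ i + V $ j) else V $ k) =
    (1/2) * det (\<chi> k. if k = i then V $ i + V $ j else V $ k)"
    by (rule det_row_mul)
  also have "det (\<chi> k. if k = i then V $ i + V $ j else V $ k) = det V"
    using det_row_operation[OF assms, of V 1] by (simp add: row_def cong: if_cong)
  finally show ?thesis by (simp add: scalar_mult_eq_scaleR cong: if_cong)
qed

section \<open>Equivariant valuations and the edge cut\<close>

locale sl_equivariant_valuation =
  fixes \<Psi> :: "(real ^ 'n \<Rightarrow> real) \<Rightarrow> real ^ 'n"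
  assumes dim_ge_2: "CARD('n) \<ge> 2"
    and continuous: "continuous_map epi_topology euclidean \<Psi>"
    and invariant: "dually_epi_translation_invariant \<Psi>"
    and equivariant: "SL_equivariant \<Psi>"
    and valuation: "is_valuation \<Psi>"
begin

lemma Psi_tendsto:
  assumes "\<And>k. F k \<in> Conv" "f \<in> Conv" "epi_converges F f"
  shows "(\<lambda>k. \<Psi> (F k)) \<longlonglongrightarrow> \<Psi> f"
  using continuous_map_limit[OF continuous limitin_epi_topology[OF assms]]
  by (simp add: o_def)

lemma Psi_add_affine:
  fixes p :: "(real ^ 'n) \<times> real"
  assumes "f \<in> Conv"
  shows "\<Psi> (\<lambda>x. f x + p \<bullet> (x, 1)) = \<Psi> f"
proof -
  have "linear (\<lambda>x. fst p \<bullet> x)" by (simp add: linear_iff inner_add_right)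
  with invariant assms have "\<Psi> (\<lambda>x. f x + (fst p \<bullet> x + snd p)) = \<Psi> f"
    unfolding dually_epi_translation_invariant_def by blast
  then show ?thesis by (simp add: inner_prod_def)
qed

lemma Psi_valuation:
  assumes "f \<in> Conv" "h \<in> Conv" "G \<in> Conv"
    and "\<And>x. F x = max (f x) (h x)" "\<And>x. G x = min (f x) (h x)"
  shows "\<Psi> F + \<Psi> G = \<Psi> f + \<Psi> h"
proof -
  have "F = (\<lambda>x. max (f x) (h x))" "G = (\<lambda>x. min (f x) (h x))" using assms by auto
  with valuation assms(1-3) show ?thesis by (simp add: is_valuation_def)
qed

text \<open>
  The form in which equivariance is used: the vanishing of \<open>\<Psi>\<close> may be tested after a
  volume-preserving change of variables.
\<close>

lemma Psi_zero_if_compose_SL: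
  assumes f: "f \<in> Conv" and G: "det G = 1" and zero: "\<Psi> (f \<circ> (\<lambda>x. G *v x)) = 0"
  shows "\<Psi> f = 0"
proof -
  have "invertible G" using G by (simp add: invertible_det_nz)
  then obtain g where g: "G ** g = mat 1" "g ** G = mat 1"
    by (auto simp: invertible_def)
  then have "det G * det g = 1" by (metis det_I det_mul)
  then have det_g: "det g = 1" using G by simp
  have "invertible g" using g by (auto simp: invertible_def)
  then have "g ** matrix_inv g = mat 1"
    unfolding invertible_def matrix_inv_def by (rule someI2_ex) simp
  then have "matrix_inv g = G"
    by (metis g(1) matrix_mul_assoc matrix_mul_lid matrix_mul_rid)
  then have "g *v \<Psi> f = 0"
    using equivariant f det_g zero by (metis SL_equivariant_def)
  then have "(G ** g) *v \<Psi> f = 0" by (simp flip: matrix_vector_mul_assoc)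
  then show ?thesis by (simp add: g)
qed

text \<open>
  The vector \<open>\<Psi> 0\<close> is fixed by every matrix of determinant one, in particular by the diagonal
  matrices that double one coordinate and halve another.
\<close>

lemma Psi_0: "\<Psi> (\<lambda>x. 0) = 0"
proof (rule vec_eq_iff[THEN iffD2], rule allI)
  fix i :: 'n
  have "UNIV \<noteq> {i}" using dim_ge_2
    by (metis card_1_singleton_iff One_nat_def not_less_eq_eq numeral_2_eq_2 order_refl)
  then obtain j where j: "j \<noteq> i" by auto
  define g :: "real ^ 'n ^ 'n" where
    "g = (\<chi> a b. if a = b then (if a = i then 2 else if a = j then 1/2 else 1) else 0)"
  have "det g = (\<Prod>a\<in>UNIV. g $ a $ a)" by (rule det_diagonal) (simp add: g_def)
  also have "\<dots> = (\<Prod>a\<in>UNIV. if a = i then 2 else if a = j then 1/2 else 1)"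
    by (simp add: g_def)
  also have "\<dots> = (\<Prod>a\<in>{i, j}. if a = i then 2 else if a = j then 1/2 else 1)"
    by (rule prod.mono_neutral_right) auto
  also have "\<dots> = 1" using j by simp
  finally have "det g = 1" .
  moreover have "(\<lambda>x :: real ^ 'n. 0 :: real) \<in> Conv"
    using Conv_affine[of 0] by simp
  ultimately have "\<Psi> ((\<lambda>x. 0) \<circ> (\<lambda>x. matrix_inv g *v x)) = g *v \<Psi> (\<lambda>x. 0)"
    using equivariant unfolding SL_equivariant_def by blast
  then have "\<Psi> (\<lambda>x. 0) $ i = (g *v \<Psi> (\<lambda>x. 0)) $ i" by (simp add: o_def)
  also have "\<dots> = (\<Sum>b\<in>UNIV. (if i = b then 2 else 0) * \<Psi> (\<lambda>x. 0) $ b)"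
    by (auto simp: matrix_vector_mult_def g_def intro!: sum.cong)
  also have "\<dots> = (\<Sum>b\<in>UNIV. if i = b then 2 * \<Psi> (\<lambda>x. 0) $ b else 0)"
    by (rule sum.cong) auto
  also have "\<dots> = 2 * \<Psi> (\<lambda>x. 0) $ i" by simp
  finally show "\<Psi> (\<lambda>x. 0) $ i = 0 $ i" by simp
qed

text \<open>
  Among the pieces, \<open>l\<close> lies pointwise between \<open>a\<close> and \<open>b\<close>. So \<open>min (max a l) (max l b) = l\<close> and, by
  distributivity, the two functions that occur with a positive sign on the right have the maximum
  over \<open>insert l R\<close> as their minimum. Its convexity is what the valuation property asks for.
\<close>

lemma edge_cut:
  assumes "l \<in> closed_segment a b" "finite R" "R \<noteq> {}"
  shows "\<Psi> (max_affine (insert a (insert b R))) =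
    \<Psi> (max_affine (insert a (insert l R))) + \<Psi> (max_affine (insert l (insert b R)))
      - \<Psi> (max_affine (insert l R))"
proof -
  have between: "min (a \<bullet> (x, 1)) (b \<bullet> (x, 1)) \<le> l \<bullet> (x, 1)"
      "l \<bullet> (x, 1) \<le> max (a \<bullet> (x, 1)) (b \<bullet> (x, 1))" for x
  proof -
    from assms(1) obtain u where u: "0 \<le> u" "u \<le> 1" "l = (1 - u) *\<^sub>R a + u *\<^sub>R b"
      by (auto simp: closed_segment_def)
    let ?s = "a \<bullet> (x, 1)" and ?t = "b \<bullet> (x, 1)"
    have "(1 - u) * min ?s ?t \<le> (1 - u) * ?s" "(1 - u) * ?s \<le> (1 - u) * max ?s ?t"
        "u * min ?s ?t \<le> u * ?t" "u * ?t \<le> u * max ?s ?t"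
      using u by (auto intro!: mult_left_mono)
    moreover have "l \<bullet> (x, 1) = (1 - u) * ?s + u * ?t"
      by (simp add: u(3) inner_add_left)
    moreover have "(1 - u) * min ?s ?t + u * min ?s ?t = min ?s ?t"
        "(1 - u) * max ?s ?t + u * max ?s ?t = max ?s ?t"
      by (simp_all add: algebra_simps)
    ultimately show "min ?s ?t \<le> l \<bullet> (x, 1)" "l \<bullet> (x, 1) \<le> max ?s ?t" by linarith+
  qed
  have "\<Psi> (max_affine (insert a (insert b R))) + \<Psi> (max_affine (insert l R)) =
    \<Psi> (max_affine (insert a (insert l R))) + \<Psi> (max_affine (insert l (insert b R)))"
  proof (rule Psi_valuation)
    fix x
    show "max_affine (insert a (insert b R)) x =
      max (max_affine (insert a (insert l R)) x) (max_affine (insert l (insert b R)) x)"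
      using between[of x] assms by (simp add: max_affine_insert)
    show "max_affine (insert l R) x =
      min (max_affine (insert a (insert l R)) x) (max_affine (insert l (insert b R)) x)"
      using between[of x] assms by (simp add: max_affine_insert)
  qed (use assms in \<open>auto intro!: Conv_max_affine\<close>)
  then show ?thesis by (simp add: algebra_simps)
qed

section \<open>Compact support\<close>

text \<open>
  For an affine \<open>l\<close>, a maximum \<open>f\<close> and \<open>g = max l f\<close>, the functions \<open>m f + g + h\<close> and \<open>m g + l + h\<close>
  have maximum \<open>(m + 1) g + h\<close> and minimum \<open>m f + l + h\<close>. Since \<open>l\<close> may be dropped,
  the valuation property expresses the difference of \<open>m \<mapsto> \<Psi> (m g + h)\<close> by two sequences for \<open>f\<close>
  instead of \<open>g\<close>, to which induction applies. The summand \<open>h\<close> is there because one of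
  these two sequences has \<open>g + h\<close> in its place; the degree has to be the same for all \<open>h\<close> so that
  the two sequences can be subtracted.
\<close>

lemma poly_seq_Psi_multiple:
  assumes "finite A" "A \<noteq> {}"
  shows "\<exists>d. \<forall>h\<in>Conv. poly_seq d (\<lambda>m. \<Psi> (\<lambda>x. real m * max_affine A x + h x))"
  using assms
proof (induction A rule: finite_ne_induct)
  case (singleton p)
  have "\<Psi> (\<lambda>x. real m * max_affine {p} x + h x) = \<Psi> h" if "h \<in> Conv" for m h
    using Psi_add_affine[OF that, of "real m *\<^sub>R p"] by (simp add: add.commute)
  then show ?case by (intro exI[of _ 0]) simp
next
  case (insert p A)
  let ?l = "\<lambda>x. p \<bullet> (x, 1)" and ?f = "max_affine A"
  let ?g = "max_affine (insert p A)"
  have g: "?g x = max (?l x) (?f x)" for x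
    using insert by (simp add: max_affine_insert)
  have conv: "?f \<in> Conv" "?g \<in> Conv" using insert by (auto intro!: Conv_max_affine)
  obtain d where d: "\<And>h. h \<in> Conv \<Longrightarrow> poly_seq d (\<lambda>m. \<Psi> (\<lambda>x. real m * ?f x + h x))"
    using insert.IH by blast
  have "poly_seq (Suc d) (\<lambda>m. \<Psi> (\<lambda>x. real m * ?g x + h x))" if h: "h \<in> Conv" for h
  proof -
    have difference: "\<Psi> (\<lambda>x. real (Suc m) * ?g x + h x) - \<Psi> (\<lambda>x. real m * ?g x + h x) =
      \<Psi> (\<lambda>x. real m * ?f x + (?g x + h x)) - \<Psi> (\<lambda>x. real m * ?f x + h x)" for m
    proof -
      note conv_intros = Conv_add Conv_cmul conv h Conv_affine
      have cut: "\<Psi> (\<lambda>x. real (Suc m) * ?g x + h x) + \<Psi> (\<lambda>x. (real m * ?f x + h x) + ?l x) =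
        \<Psi> (\<lambda>x. real m * ?f x + (?g x + h x)) + \<Psi> (\<lambda>x. (real m * ?g x + h x) + ?l x)"
      proof (rule Psi_valuation)
        fix x
        have *: "real m * min (?l x) (?f x) \<le> real m * max (?l x) (?f x)"
          by (intro mult_left_mono) auto
        show "real (Suc m) * ?g x + h x =
          max (real m * ?f x + (?g x + h x)) ((real m * ?g x + h x) + ?l x)"
          using * by (cases "?l x \<le> ?f x") (auto simp: g max_def min_def algebra_simps)
        show "(real m * ?f x + h x) + ?l x =
          min (real m * ?f x + (?g x + h x)) ((real m * ?g x + h x) + ?l x)"
          using * by (cases "?l x \<le> ?f x") (auto simp: g max_def min_def algebra_simps)
      qed (intro conv_intros; simp)+
      have absorb: "\<Psi> (\<lambda>x. (real m * k x + h x) + ?l x) = \<Psi> (\<lambda>x. real m * k x + h x)"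
        if "k \<in> Conv" for k
        using that by (intro Psi_add_affine conv_intros) auto
      have rearrange: "a - d = c - b" if "a + b = c + d" for a b c d :: "real ^ 'n"
        using that by (simp add: algebra_simps)
      show ?thesis using cut unfolding absorb[OF conv(1)] absorb[OF conv(2)] by (rule rearrange)
    qed
    have "poly_seq d (\<lambda>m. \<Psi> (\<lambda>x. real m * ?f x + (?g x + h x)) - \<Psi> (\<lambda>x. real m * ?f x + h x))"
      using d[OF Conv_add[OF conv(2) h]] d[OF h] by (rule poly_seq_diff)
    then show ?thesis unfolding poly_seq.simps difference .
  qed
  then show ?case by blast
qed

definition vanishing_radius :: "real \<Rightarrow> bool" where
  "vanishing_radius r \<longleftrightarrow> 0 < r \<and> (\<forall>A. finite A \<longrightarrow> A \<noteq> {} \<longrightarrow>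
    (\<forall>x. norm x \<le> r \<longrightarrow> max_affine A x = 0) \<longrightarrow> \<Psi> (max_affine A) = 0)"

text \<open>
  If there were no such radius, there would be \<open>f\<^sub>k\<close> vanishing on the ball of radius \<open>k + 1\<close> with
  \<open>\<Psi> f\<^sub>k \<noteq> 0\<close>. A nonconstant polynomial is unbounded, hence suitable multiples \<open>m\<^sub>k f\<^sub>k\<close> have values
  of norm greater than one. They still converge to \<open>0\<close>, contradicting the continuity of \<open>\<Psi>\<close> at \<open>0\<close>.
\<close>

lemma vanishing_radius_exists: "\<exists>r. vanishing_radius r"
proof (rule ccontr)
  assume no: "\<not> ?thesis"
  have "\<exists>A m. finite A \<and> A \<noteq> {} \<and> (\<forall>x. norm x \<le> real (Suc k) \<longrightarrow> max_affine A x = 0) \<and>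
      1 < norm (\<Psi> (\<lambda>x. real m * max_affine A x))" for k
  proof -
    have "\<not> vanishing_radius (real (Suc k))" using no by blast
    then obtain A where A: "finite A" "A \<noteq> {}" "\<And>x. norm x \<le> real (Suc k) \<Longrightarrow> max_affine A x = 0"
        "\<Psi> (max_affine A) \<noteq> 0"
      unfolding vanishing_radius_def by (metis of_nat_0_less_iff zero_less_Suc)
    define P where "P m = \<Psi> (\<lambda>x. real m * max_affine A x)" for m
    obtain d where "\<forall>h\<in>Conv. poly_seq d (\<lambda>m. \<Psi> (\<lambda>x. real m * max_affine A x + h x))"
      using poly_seq_Psi_multiple A by blast
    moreover have "(\<lambda>x :: real ^ 'n. 0 :: real) \<in> Conv" using Conv_affine[of 0] by simp
    ultimately have "poly_seq d P" unfolding P_def by fastforce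
    moreover have "P 1 \<noteq> P 0" using A(4) by (simp add: P_def Psi_0)
    ultimately have "\<not> bounded (range P)" using bounded_poly_seq_const by blast
    then have "\<not> (\<forall>p\<in>range P. norm p \<le> 1)" unfolding bounded_iff by blast
    then obtain m where "1 < norm (P m)" by (auto simp: not_le)
    with A show ?thesis unfolding P_def by blast
  qed
  then obtain A m where A: "\<And>k. finite (A k)" "\<And>k. A k \<noteq> {}"
      "\<And>k x. norm x \<le> real (Suc k) \<Longrightarrow> max_affine (A k) x = 0"
      "\<And>k. 1 < norm (\<Psi> (\<lambda>x. real (m k) * max_affine (A k) x))"
    by metis
  define F where "F k = (\<lambda>x. real (m k) * max_affine (A k) x)" for k
  have "epi_converges F (\<lambda>x. 0)"
  proof (rule epi_converges_if_continuous_convergence)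
    fix x :: "real ^ 'n" and X assume "X \<longlonglongrightarrow> x"
    then have "(\<lambda>k. norm (X k)) \<longlonglongrightarrow> norm x" by (rule tendsto_norm)
    then have "\<forall>\<^sub>F k in sequentially. norm (X k) < norm x + 1" by (rule order_tendstoD) simp
    moreover have "\<forall>\<^sub>F k in sequentially. norm x + 1 \<le> real k"
      using filterlim_real_sequentially by (simp add: filterlim_at_top)
    ultimately have "\<forall>\<^sub>F k in sequentially. F k (X k) = 0"
      by eventually_elim (simp add: F_def A(3))
    then show "(\<lambda>k. F k (X k)) \<longlonglongrightarrow> 0" by (rule tendsto_eventually)
  qed
  moreover have "F k \<in> Conv" for k
    unfolding F_def using A by (intro Conv_cmul Conv_max_affine) auto
  moreover have "(\<lambda>x :: real ^ 'n. 0 :: real) \<in> Conv" using Conv_affine[of 0] by simp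
  ultimately have "(\<lambda>k. \<Psi> (F k)) \<longlonglongrightarrow> 0" using Psi_tendsto Psi_0 by metis
  then have "(\<lambda>k. norm (\<Psi> (F k))) \<longlonglongrightarrow> 0" by (rule tendsto_norm_zero)
  then have "\<forall>\<^sub>F k in sequentially. norm (\<Psi> (F k)) < 1" by (rule order_tendstoD) simp
  then obtain k where "norm (\<Psi> (F k)) < 1" by (auto simp: eventually_sequentially)
  with A(4)[of k] show False by (simp add: F_def)
qed

section \<open>Maxima with linearly independent gradients\<close>

text \<open>
  The pieces of \<open>max 0 (v\<^sub>i \<bullet> x - c\<^sub>i)\<close>, where \<open>v\<^sub>i\<close> are the rows of \<open>V\<close> with index in \<open>I\<close>. Always
  having a full matrix, even if only some rows occur, makes a determinant available.
\<close>

abbreviation hinges :: "real ^ 'n ^ 'n \<Rightarrow> ('n \<Rightarrow> real) \<Rightarrow> 'n set \<Rightarrow> ((real ^ 'n) \<times> real) set" where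
  "hinges V c I \<equiv> insert 0 ((\<lambda>i. (V $ i, - c i)) ` I)"

text \<open>
  The matrix \<open>G = inv V diag s\<close> has determinant one and turns \<open>v\<^sub>i \<bullet> x\<close> into \<open>s\<^sub>i x\<^sub>i\<close>, which is at most
  \<open>c\<^sub>i\<close> on the ball of radius \<open>r\<close>. So the transformed function vanishes there.
\<close>

lemma Psi_hinges_zero_if_scaled:
  assumes r: "vanishing_radius r" and V: "det V \<noteq> 0"
    and s: "(\<Prod>i\<in>UNIV. s i) = det V" "\<And>i. i \<in> I \<Longrightarrow> \<bar>s i\<bar> * r \<le> c i"
  shows "\<Psi> (max_affine (hinges V c I)) = 0"
proof -
  define D :: "real ^ 'n ^ 'n" where "D = (\<chi> i j. if i = j then s i else 0)"
  have "invertible V" using V by (simp add: invertible_det_nz)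
  then obtain W where W: "V ** W = mat 1" by (auto simp: invertible_def)
  define G where "G = W ** D"
  have VG: "V ** G = D" by (simp add: G_def matrix_mul_assoc W)
  have "det D = (\<Prod>i\<in>UNIV. D $ i $ i)" by (rule det_diagonal) (simp add: D_def)
  then have "det D = det V" by (simp add: D_def s)
  moreover have "det V * det G = det D" by (simp flip: VG det_mul)
  ultimately have det_G: "det G = 1" using V by simp
  have VG_nth: "V $ i \<bullet> (G *v x) = s i * x $ i" for i x
  proof -
    have "V $ i \<bullet> (G *v x) = (V *v (G *v x)) $ i"
      by (simp add: matrix_vector_mul_component)
    also have "\<dots> = (D *v x) $ i" by (simp add: matrix_vector_mul_assoc VG)
    also have "\<dots> = (\<Sum>j\<in>UNIV. (if i = j then s i else 0) * x $ j)"
      by (simp add: D_def matrix_vector_mult_def)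
    also have "\<dots> = (\<Sum>j\<in>UNIV. if i = j then s i * x $ j else 0)"
      by (rule sum.cong) auto
    finally show ?thesis by simp
  qed
  let ?A = "hinges V c I"
  have A: "finite ?A" "?A \<noteq> {}" by auto
  let ?B = "(\<lambda>p. (fst p v* G, snd p)) ` ?A"
  have B: "max_affine ?B x = max_affine ?A (G *v x)" for x
    using max_affine_cong_image[OF A, of "\<lambda>p. (fst p v* G, snd p)" x "G *v x" 0]
    by (simp add: inner_prod_def dot_lmul_matrix)
  have "max_affine ?B x = 0" if x: "norm x \<le> r" for x
  proof (rule antisym)
    have "V $ i \<bullet> (G *v x) \<le> c i" if "i \<in> I" for i
    proof -
      have "s i * x $ i \<le> \<bar>s i\<bar> * \<bar>x $ i\<bar>" by (metis abs_ge_self abs_mult)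
      also have "\<dots> \<le> \<bar>s i\<bar> * r"
        using component_le_norm_cart[of x i] x by (intro mult_left_mono) auto
      also have "\<dots> \<le> c i" using s(2) that .
      finally show ?thesis by (simp add: VG_nth)
    qed
    then show "max_affine ?B x \<le> 0"
      unfolding B by (auto simp: max_affine_le_iff inner_prod_def)
    show "0 \<le> max_affine ?B x"
      unfolding B using max_affine_ge[OF A(1), of 0 "G *v x"] by simp
  qed
  then have "\<Psi> (max_affine ?B) = 0"
    using r A unfolding vanishing_radius_def by blast
  moreover have "max_affine ?B = max_affine ?A \<circ> (\<lambda>x. G *v x)" using B by auto
  ultimately have "\<Psi> (max_affine ?A \<circ> (\<lambda>x. G *v x)) = 0" by simp
  then show ?thesis by (intro Psi_zero_if_compose_SL[OF Conv_max_affine[OF A] det_G])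
qed

text \<open>
  All scaling factors but the \<open>k\<close>-th are taken to be \<open>e / r\<close>, and the \<open>k\<close>-th is what the determinant
  requires. It is unrestricted if row \<open>k\<close> does not occur, and otherwise is at most \<open>e / r\<close> in
  absolute value when the determinant is small.
\<close>

lemma Psi_hinges_zero_if_spare_or_small:
  assumes r: "vanishing_radius r" and V: "det V \<noteq> 0"
    and e: "0 < e" "\<And>i. e \<le> c i"
    and k: "k \<notin> I \<or> \<bar>det V\<bar> \<le> (e / r) ^ CARD('n)"
  shows "\<Psi> (max_affine (hinges V c I)) = 0"
proof -
  have "0 < r" using r by (simp add: vanishing_radius_def)
  define t where "t = e / r"
  have t: "t > 0" "t * r = e" using \<open>0 < r\<close> e by (auto simp: t_def)
  \<comment> \<open>The exponent is \<open>n - 1\<close> since the other factors of the product contribute \<open>t\<close> each.\<close>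
  define s where "s i = (if i = k then det V / t ^ (CARD('n) - 1) else t)" for i :: 'n
  have "(\<Prod>i\<in>UNIV. s i) = s k * (\<Prod>i\<in>UNIV - {k}. s i)" by (rule prod.remove) auto
  also have "(\<Prod>i\<in>UNIV - {k}. s i) = (\<Prod>i\<in>UNIV - {k}. t)" by (rule prod.cong) (auto simp: s_def)
  also have "s k * \<dots> = det V" using t by (simp add: s_def card_Diff_singleton)
  finally have "(\<Prod>i\<in>UNIV. s i) = det V" .
  moreover have "\<bar>s i\<bar> * r \<le> c i" if "i \<in> I" for i
  proof -
    have "\<bar>s i\<bar> \<le> t"
    proof (cases "i = k")
      case True
      with that k have "\<bar>det V\<bar> \<le> t ^ CARD('n)" by (auto simp: t_def)
      also have "t ^ CARD('n) = t * t ^ (CARD('n) - 1)"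
        using dim_ge_2 by (metis power_eq_if zero_neq_numeral le_zero_eq)
      finally show ?thesis using t True by (simp add: s_def abs_divide pos_divide_le_eq)
    qed (use t in \<open>simp add: s_def\<close>)
    then have "\<bar>s i\<bar> * r \<le> t * r" using \<open>0 < r\<close> by simp
    with t(2) e(2)[of i] show ?thesis by simp
  qed
  ultimately show ?thesis by (rule Psi_hinges_zero_if_scaled[OF r V])
qed

text \<open>
  The lower bound \<open>e\<close> for the \<open>c\<^sub>i\<close> survives the midpoint cut because an average of two of them is again
  at least \<open>e\<close>, while the determinant is halved. The subtracted term of \<open>edge_cut\<close> lacks the row \<open>i\<close>, so
  it vanishes irrespective of the size of the determinant.
\<close>

lemma Psi_hinges_zero_induct:
  assumes r: "vanishing_radius r" and e: "0 < e"
  shows "det V \<noteq> 0 \<Longrightarrow> (\<And>i. e \<le> c i) \<Longrightarrow> \<bar>det V\<bar> \<le> 2 ^ m * (e / r) ^ CARD('n) \<Longrightarrow>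
    \<Psi> (max_affine (hinges V c UNIV)) = 0"
proof (induction m arbitrary: V c)
  case 0
  then show ?case using Psi_hinges_zero_if_spare_or_small[OF r 0(1) e] by auto
next
  case (Suc m)
  obtain i j :: 'n where ij: "i \<noteq> j"
  proof -
    obtain T :: "'n set" where "card T = 2"
      using obtain_subset_with_card_n[OF dim_ge_2] by blast
    then show thesis using that unfolding card_2_iff by blast
  qed
  define W where "W k = (\<chi> a. if a = k then (1/2) *\<^sub>R (V $ i + V $ j) else V $ a)" for k
  define d where "d k a = (if a = k then (c i + c j) / 2 else c a)" for k a
  have det_W: "det (W i) = det V / 2" "det (W j) = det V / 2"
    using det_midpoint_row[OF ij, of V] det_midpoint_row[OF ij[symmetric], of V]
    by (simp_all add: W_def add.commute cong: if_cong)
  have d: "e \<le> d k a" for k a using Suc.prems(2)[of i] Suc.prems(2)[of j] Suc.prems(2)[of a]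
    by (simp add: d_def)
  define K where "K = UNIV - {i, j}"
  define R where "R = hinges V c K"
  let ?a = "(V $ i, - c i)" and ?b = "(V $ j, - c j)"
  let ?l = "((1/2) *\<^sub>R (V $ i + V $ j), - ((c i + c j) / 2))"
  have rest: "(\<lambda>a. (W k $ a, - d k a)) ` K = (\<lambda>a. (V $ a, - c a)) ` K" if "k \<in> {i, j}" for k
    using that by (intro image_cong) (auto simp: W_def d_def K_def)
  have UNIV_eq: "UNIV = insert i (insert j K)" "UNIV - {i} = insert j K"
    using ij by (auto simp: K_def)
  have "hinges V c UNIV = insert ?a (insert ?b R)"
    unfolding UNIV_eq(1) R_def by (simp add: insert_commute)
  moreover have "hinges (W j) (d j) UNIV = insert ?a (insert ?l R)"
    unfolding UNIV_eq(1) R_def image_insert rest[of j, simplified]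
    using ij by (simp add: W_def d_def insert_commute)
  moreover have "hinges (W i) (d i) UNIV = insert ?l (insert ?b R)"
    unfolding UNIV_eq(1) R_def image_insert rest[of i, simplified]
    using ij by (simp add: W_def d_def insert_commute)
  moreover have "hinges (W j) (d j) (UNIV - {i}) = insert ?l R"
    unfolding UNIV_eq(2) R_def image_insert rest[of j, simplified]
    by (simp add: W_def d_def insert_commute)
  moreover have "?l \<in> closed_segment ?a ?b"
    unfolding closed_segment_def
    by (intro CollectI exI[of _ "1/2"]) (auto simp: algebra_simps add_divide_distrib)
  moreover have "finite R" "R \<noteq> {}" by (auto simp: R_def)
  moreover have "\<Psi> (max_affine (hinges (W i) (d i) UNIV)) = 0"
      "\<Psi> (max_affine (hinges (W j) (d j) UNIV)) = 0"
    using det_W Suc.prems d by (intro Suc.IH; simp add: abs_divide)+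
  moreover have "\<Psi> (max_affine (hinges (W j) (d j) (UNIV - {i}))) = 0"
    using det_W Suc.prems(1) d
    by (intro Psi_hinges_zero_if_spare_or_small[OF r _ e, where k = i]) auto
  ultimately show ?case using edge_cut[of ?l ?a ?b R] by simp
qed

lemma Psi_hinges_zero:
  assumes V: "det V \<noteq> 0" and c: "\<And>i. 0 < c i"
  shows "\<Psi> (max_affine (hinges V c I)) = 0"
proof -
  obtain r where r: "vanishing_radius r" using vanishing_radius_exists by blast
  then have "0 < r" by (simp add: vanishing_radius_def)
  define e where "e = Min (range c)"
  have e: "0 < e" "\<And>i. e \<le> c i" using c by (auto simp: e_def)
  show ?thesis
  proof (cases "I = UNIV")
    case True
    define q where "q = (e / r) ^ CARD('n)"
    have "q > 0" using e(1) \<open>0 < r\<close> by (simp add: q_def)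
    obtain m where "\<bar>det V\<bar> / q < 2 ^ m" using real_arch_pow[of 2 "\<bar>det V\<bar> / q"] by auto
    then have "\<bar>det V\<bar> \<le> 2 ^ m * q" using \<open>q > 0\<close> by (simp add: pos_divide_less_eq)
    then show ?thesis
      unfolding True using Psi_hinges_zero_induct[OF r e(1) V e(2)] by (simp add: q_def)
  next
    case False
    then obtain k where "k \<notin> I" by auto
    then show ?thesis by (intro Psi_hinges_zero_if_spare_or_small[OF r V e, where k = k]) simp_all
  qed
qed

text \<open>
  Independent gradients extend to a basis, which gives the rows of the matrix \<open>V\<close>.
\<close>

lemma Psi_zero_if_independent_gradients_neg:
  assumes B: "finite B" "inj_on fst B" "independent (fst ` B)" and neg: "\<And>p. p \<in> B \<Longrightarrow> snd p < 0"
  shows "\<Psi> (max_affine (insert 0 B)) = 0"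
proof -
  obtain S where S: "fst ` B \<subseteq> S" "independent S" "UNIV \<subseteq> span S"
    using maximal_independent_subset_extend[OF subset_UNIV B(3)] by metis
  then have span_S: "span S = UNIV" by (simp only: top.extremum_unique)
  have "card S = CARD('n)" 
    using dim_eq_card_independent[OF S(2)] dim_span[of S] span_S by (simp add: dim_UNIV)
  moreover have "finite S" using S(2) by (rule independent_imp_finite)
  ultimately obtain f where f: "bij_betw f (UNIV :: 'n set) S"
    using finite_same_card_bij[of "UNIV :: 'n set" S] by auto
  then have range_f: "range f = S" by (simp add: bij_betw_def)
  define V :: "real ^ 'n ^ 'n" where "V = (\<chi> i. f i)"
  have "rows V = S" using range_f by (auto simp: rows_def row_def V_def)
  then have "\<exists>U. U ** V = mat 1" using span_S by (simp add: matrix_left_invertible_span_rows)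
  then have "det V \<noteq> 0" by (metis det_I det_mul mult_zero_right zero_neq_one)
  \<comment> \<open>The basis vectors outside the gradients of \<open>B\<close> get the arbitrary positive constant \<open>1\<close>.\<close>
  define lift where "lift v = inv_into B fst v" for v
  have lift: "p \<in> B \<Longrightarrow> lift (fst p) = p" for p using B(2) by (simp add: lift_def)
  define c where "c i = (if f i \<in> fst ` B then - snd (lift (f i)) else 1)" for i
  have "0 < c i" for i using neg lift by (auto simp: c_def)
  define I where "I = f -` (fst ` B)"
  have "(\<lambda>i. (V $ i, - c i)) ` I = (\<lambda>i. lift (f i)) ` I"
    using lift by (intro image_cong) (auto simp: I_def V_def c_def)
  also have "\<dots> = lift ` (f ` I)" by (simp add: image_image)
  also have "f ` I = fst ` B" using S(1) range_f by (auto simp: I_def)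
  also have "lift ` (fst ` B) = B" using lift by (force simp: image_image)
  finally have "hinges V c I = insert 0 B" by simp
  with Psi_hinges_zero[OF \<open>det V \<noteq> 0\<close>, of c I] \<open>\<And>i. 0 < c i\<close> show ?thesis by simp
qed

text \<open>
  Lowering all pieces but \<open>0\<close> by a small amount makes the constants strictly negative and changes the
  maximum uniformly little.
\<close>

lemma Psi_zero_if_independent_gradients_nonpos:
  assumes B: "finite B" "inj_on fst B" "independent (fst ` B)" and nonpos: "\<And>p. p \<in> B \<Longrightarrow> snd p \<le> 0"
  shows "\<Psi> (max_affine (insert 0 B)) = 0"
proof -
  define B' where "B' k = (\<lambda>p. p - (0, inverse (real (Suc k)))) ` B" for k
  have fin: "finite (B' k)" for k using B by (simp add: B'_def)
  have fst_B': "fst ` B' k = fst ` B" for k by (simp add: B'_def image_image)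
  have zero: "\<Psi> (max_affine (insert 0 (B' k))) = 0" for k
  proof (rule Psi_zero_if_independent_gradients_neg[OF fin])
    show "inj_on fst (B' k)"
      using B(2) by (auto simp: B'_def inj_on_def)
    show "independent (fst ` B' k)" using B(3) by (simp add: fst_B')
    show "snd p < 0" if p: "p \<in> B' k" for p
    proof -
      define e where "e = inverse (real (Suc k))"
      then have "0 < e" by simp
      moreover obtain p' where "p' \<in> B" "p = p' - (0, e)"
        using p unfolding B'_def e_def by blast
      ultimately show ?thesis using nonpos[of p'] by simp
    qed
  qed
  have close: "\<bar>max_affine (insert 0 (B' k)) x - max_affine (insert 0 B) x\<bar> \<le> inverse (real (Suc k))" for k x
  proof -
    let ?e = "inverse (real (Suc k))" and ?f = "max_affine (insert 0 B) x"
      and ?g = "max_affine (insert 0 (B' k)) x"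
    have "?e > 0" by simp
    have f: "0 \<le> ?f" using max_affine_ge[of "insert 0 B" 0 x] B(1) by simp
    have f': "p \<bullet> (x, 1) \<le> ?f" if "p \<in> B" for p
      using B(1) that by (intro max_affine_ge) auto
    have g: "0 \<le> ?g" using max_affine_ge[of "insert 0 (B' k)" 0 x] fin by simp
    have g': "p \<bullet> (x, 1) \<le> ?g" if "p \<in> B' k" for p
      using fin that by (intro max_affine_ge) auto
    have shift: "(p - (0, ?e)) \<bullet> (x, 1) = p \<bullet> (x, 1) - ?e" for p
      by (simp add: inner_diff_left)
    have "p \<bullet> (x, 1) \<le> ?f" if p: "p \<in> B' k" for p
    proof -
      obtain p' where p': "p' \<in> B" "p = p' - (0, ?e)" using p unfolding B'_def by blast
      show ?thesis using f'[OF p'(1)] \<open>?e > 0\<close> unfolding p'(2) shift by linarith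
    qed
    then have "?g \<le> ?f" using fin f by (simp add: max_affine_le_iff)
    moreover have "p \<bullet> (x, 1) \<le> ?g + ?e" if "p \<in> B" for p
    proof -
      have "p - (0, ?e) \<in> B' k" unfolding B'_def using that by (rule imageI)
      from g'[OF this] show ?thesis unfolding shift by linarith
    qed
    then have "?f \<le> ?g + ?e" using B(1) g \<open>?e > 0\<close> by (subst max_affine_le_iff) auto
    ultimately show ?thesis using \<open>?e > 0\<close> by linarith
  qed
  have conv: "max_affine (insert 0 B) \<in> Conv" using B(1) by (intro Conv_max_affine) auto
  have "epi_converges (\<lambda>k. max_affine (insert 0 (B' k))) (max_affine (insert 0 B))"
  proof (rule epi_converges_if_continuous_convergence)
    fix x :: "real ^ 'n" and X assume "X \<longlonglongrightarrow> x"
    then have "(\<lambda>k. max_affine (insert 0 B) (X k)) \<longlonglongrightarrow> max_affine (insert 0 B) x"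
      by (rule Conv_tendsto[OF conv])
    moreover have "(\<lambda>k. max_affine (insert 0 (B' k)) (X k) - max_affine (insert 0 B) (X k)) \<longlonglongrightarrow> 0"
      using close by (intro Lim_null_comparison[OF _ LIMSEQ_inverse_real_of_nat] always_eventually) auto
    ultimately have "(\<lambda>k. max_affine (insert 0 B) (X k) +
        (max_affine (insert 0 (B' k)) (X k) - max_affine (insert 0 B) (X k)))
      \<longlonglongrightarrow> max_affine (insert 0 B) x + 0"
      by (rule tendsto_add)
    then show "(\<lambda>k. max_affine (insert 0 (B' k)) (X k)) \<longlonglongrightarrow> max_affine (insert 0 B) x"
      by simp
  qed
  then have "(\<lambda>k. \<Psi> (max_affine (insert 0 (B' k)))) \<longlonglongrightarrow> \<Psi> (max_affine (insert 0 B))"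
    using fin B(1) by (intro Psi_tendsto Conv_max_affine) auto
  then have "(\<lambda>k :: nat. 0) \<longlonglongrightarrow> \<Psi> (max_affine (insert 0 B))" by (simp add: zero)
  then show ?thesis by (simp add: LIMSEQ_const_iff)
qed

text \<open>
  Subtracting the piece that is largest at the origin does not change \<open>\<Psi>\<close> and leaves the piece \<open>0\<close>
  together with pieces that are nonpositive at the origin.
\<close>

lemma Psi_zero_if_affinely_independent_gradients:
  assumes A: "finite A" "A \<noteq> {}" "inj_on fst A" "\<not> affine_dependent (fst ` A)"
  shows "\<Psi> (max_affine A) = 0"
proof -
  obtain a where a: "a \<in> A" "\<And>p. p \<in> A \<Longrightarrow> snd p \<le> snd a"
  proof -
    have "Max (snd ` A) \<in> snd ` A" using A by simp
    then obtain a where "a \<in> A" "snd a = Max (snd ` A)" by force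
    with A(1) show thesis by (intro that[of a]) auto
  qed
  define B where "B = (\<lambda>p. p - a) ` (A - {a})"
  have B: "insert 0 B = (\<lambda>p. p - a) ` A" using a(1) by (auto simp: B_def image_iff)
  have "max_affine (insert 0 B) x = max_affine A x - a \<bullet> (x, 1)" for x
    unfolding B using max_affine_cong_image[OF A(1,2), of "\<lambda>p. p - a" x x "- (a \<bullet> (x, 1))"]
    by (simp add: inner_diff_left)
  then have "max_affine A = (\<lambda>x. max_affine (insert 0 B) x + a \<bullet> (x, 1))" by auto
  moreover have "max_affine (insert 0 B) \<in> Conv"
    using A(1) by (intro Conv_max_affine) (auto simp: B_def)
  ultimately have "\<Psi> (max_affine A) = \<Psi> (max_affine (insert 0 B))"
    using Psi_add_affine by metis
  also have "\<dots> = 0"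
  proof (rule Psi_zero_if_independent_gradients_nonpos)
    show "finite B" using A by (simp add: B_def)
    show "inj_on fst B" using A(3) by (auto simp: B_def inj_on_def)
    have "fst ` (A - {a}) = fst ` A - {fst a}"
      using A(3) a(1) by (auto simp: inj_on_def)
    moreover have "fst ` B = (\<lambda>v. - fst a + v) ` (fst ` (A - {a}))"
      by (simp add: B_def image_image)
    ultimately have "fst ` B = (\<lambda>v. - fst a + v) ` (fst ` A - {fst a})" by simp
    then show "independent (fst ` B)"
      using A(4) a(1) affine_dependent_iff_dependent2[of "fst a" "fst ` A"] by simp
    show "snd p \<le> 0" if "p \<in> B" for p using that a(2) by (auto simp: B_def)
  qed
  finally show ?thesis .
qed

section \<open>Reduction to affinely independent gradients\<close>

text \<open>
  Initially, \<open>J\<close> and \<open>I\<close> are the two sides of a Radon partition, \<open>J\<close> being the lower one. Cutting an edge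
  inside \<open>J\<close> at the point found by merging replaces two pieces of \<open>J\<close> by one and moves an old
  piece to \<open>I\<close>, where it can only enlarge the maximum that bounds \<open>p\<close>. In the end \<open>J\<close>
  consists of \<open>p\<close> alone, which is dominated by the pieces of \<open>I\<close> and can be dropped, so that fewer than
  \<open>N\<close> pieces remain. The subtracted terms have fewer pieces as well.
\<close>

lemma Psi_zero_by_merging:
  assumes smaller: "\<And>B. finite B \<Longrightarrow> B \<noteq> {} \<Longrightarrow> card B < N \<Longrightarrow> \<Psi> (max_affine B) = 0"
  shows "finite J \<Longrightarrow> finite I \<Longrightarrow> J \<noteq> {} \<Longrightarrow> I \<noteq> {} \<Longrightarrow> J \<inter> I = {} \<Longrightarrow> card (J \<union> I) \<le> N \<Longrightarrow>
    p \<in> convex hull J \<Longrightarrow> (\<And>x. p \<bullet> (x, 1) \<le> max_affine I x) \<Longrightarrow> \<Psi> (max_affine (J \<union> I)) = 0"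
proof (induction "card J" arbitrary: J I rule: less_induct)
  case less
  from \<open>J \<noteq> {}\<close> obtain a where a: "a \<in> J" by blast
  show ?case
  proof (cases "J = {a}")
    case True
    with less.prems(7) have "p = a" by simp
    then have "max_affine (J \<union> I) x = max_affine I x" for x
      using less.prems(2,4) less.prems(8)[of x] True by (simp add: max_affine_insert max_absorb2)
    then have "max_affine (J \<union> I) = max_affine I" by (rule ext)
    moreover have "card I < N" using less.prems(2,5,6) True by simp
    ultimately show ?thesis using smaller less.prems by simp
  next
    case False
    then obtain b where b: "b \<in> J" "b \<noteq> a" using a by blast
    define K where "K = J - {a, b}"
    have J: "J = insert a (insert b K)" "a \<notin> K" "b \<notin> K" using a b by (auto simp: K_def)
    have K: "finite K" "K \<inter> I = {}" using less.prems by (auto simp: K_def)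
    have ab: "a \<notin> I" "b \<notin> I" using less.prems(5) a b by auto
    from less.prems(7) obtain l where l: "l \<in> closed_segment a b" "p \<in> convex hull (insert l K)"
      unfolding J(1) by (rule convex_hull_merge)
    define R where "R = K \<union> I"
    have R: "finite R" "R \<noteq> {}" using K less.prems by (auto simp: R_def)
    have card_R: "card R + 2 \<le> N"
      using less.prems(6) R J ab b by (simp add: R_def)
    \<comment> \<open>The two outer terms of the cut: \<open>z\<close> is the endpoint that is kept and moves to \<open>I\<close>. If \<open>l\<close>
      coincides with another piece, the number of pieces has dropped already.\<close>
    have half: "\<Psi> (max_affine (insert l (insert z R))) = 0" if z: "z \<in> {a, b}" for z
    proof (cases "l \<in> insert z R")
      case True
      then have "card (insert l (insert z R)) < N"
        using card_R R(1) by (simp add: insert_absorb card_insert_if)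
      then show ?thesis using smaller R by simp
    next
      case False
      have "card (insert l K) < card J"
        using J K(1) b False by (simp add: R_def)
      moreover have "insert l K \<inter> insert z I = {}"
        using False K(2) J z by (auto simp: R_def)
      moreover have "card (insert l K \<union> insert z I) \<le> N"
        using card_R R(1) False by (simp add: R_def card_insert_if)
      moreover have "p \<bullet> (x, 1) \<le> max_affine (insert z I) x" for x
        using less.prems(8)[of x] less.prems(2,4) by (simp add: max_affine_insert)
      ultimately have "\<Psi> (max_affine (insert l K \<union> insert z I)) = 0"
        using l(2) K(1) less.prems(2) by (intro less.hyps) auto
      then show ?thesis by (simp add: R_def insert_commute)
    qed
    have "card (insert l R) < N" using card_R R(1) by (simp add: card_insert_if)
    then have "\<Psi> (max_affine (insert l R)) = 0" using smaller R by simp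
    with edge_cut[OF l(1) R] half[of a] half[of b]
    have "\<Psi> (max_affine (insert a (insert b R))) = 0" by (simp add: insert_commute)
    then show ?thesis by (simp add: J(1) R_def)
  qed
qed

lemma Psi_max_affine_zero:
  "finite A \<Longrightarrow> A \<noteq> {} \<Longrightarrow> \<Psi> (max_affine A) = 0"
proof (induction "card A" arbitrary: A rule: less_induct)
  case less
  show ?case
  proof (cases "inj_on fst A \<and> \<not> affine_dependent (fst ` A)")
    case True
    with less.prems show ?thesis by (intro Psi_zero_if_affinely_independent_gradients) auto
  next
    case False
    with less.prems(1) obtain J I p q where *: "J \<union> I = A" "J \<inter> I = {}" "J \<noteq> {}" "I \<noteq> {}"
        "p \<in> convex hull J" "q \<in> convex hull I" "fst p = fst q" "snd p \<le> snd q"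
      using lifted_Radon_partition[of A] by blast
    have fin: "finite J" "finite I" using *(1) less.prems(1) by auto
    have "p \<bullet> (x, 1) \<le> max_affine I x" for x
      using convex_hull_le_max_affine[OF fin(2) *(6), of x] *(7,8) by (simp add: inner_prod_def)
    then have "\<Psi> (max_affine (J \<union> I)) = 0"
      using Psi_zero_by_merging[of "card A" J I p] less.hyps fin * by auto
    then show ?thesis using *(1) by simp
  qed
qed

end

theorem corollary5:
  fixes \<Psi> :: "(real ^ 'n \<Rightarrow> real) \<Rightarrow> real ^ 'n"
  assumes "CARD('n) \<ge> 2"
    and "continuous_map epi_topology euclidean \<Psi>"
    and "dually_epi_translation_invariant \<Psi>"
    and "SL_equivariant \<Psi>"
    and "is_valuation \<Psi>"
  shows "\<forall>f\<in>Conv. \<Psi> f = 0"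
proof
  interpret sl_equivariant_valuation \<Psi> using assms by unfold_locales
  fix f :: "real ^ 'n \<Rightarrow> real" assume f: "f \<in> Conv"
  obtain A where A: "\<And>k. finite (A k)" "\<And>k. A k \<noteq> {}" "epi_converges (\<lambda>k. max_affine (A k)) f"
    using Conv_approx_max_affine[OF f] by blast
  then have "(\<lambda>k. \<Psi> (max_affine (A k))) \<longlonglongrightarrow> \<Psi> f"
    using f by (intro Psi_tendsto Conv_max_affine) auto
  then have "(\<lambda>k :: nat. 0) \<longlonglongrightarrow> \<Psi> f" using A by (simp add: Psi_max_affine_zero)
  then show "\<Psi> f = 0" by (simp add: LIMSEQ_const_iff)
qed

end
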